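(* Let $A=\{a_0<a_1<a_2\}$ be a set of integers and $\mathbf{r}=(r_0,r_1,r_2)$ an ordered $3$-tuple of positive integers. Suppose $h$ is an integer with $2\le h\le r_0+r_1+r_2-2$. Then: (i) if $r_1=1$, then $|h^{(\mathbf{r})}A|=L(\mathbf{r},h)$; (ii) if $r_1\ge 2$, then $|h^{(\mathbf{r})}A|=L(\mathbf{r},h)$ if and only if $A$ is a $3$-term arithmetic progression.
   Context: Here $k=3$. Define $$h^{(\mathbf{r})}A=\Big\{\sum_{i=0}^{k-1}s_ia_i:\ s_i\in\mathbb{Z},\ 0\le s_i\le r_i,\ \sum_{i=0}^{k-1}s_i=h\Big\}.$$ Empty sums are $0$. Let $I_{\mathbf{r}}(h)$ be the largest integer (with $0\le I_{\mathbf{r}}(h)\le k$) such that $\sum_{j=0}^{I_{\mathbf{r}}(h)-1}r_j\le h$, and $M_{\mathbf{r}}(h)$ the least integer (with $-1\le M_{\mathbf{r}}(h)\le k-1$) such that $\sum_{j=M_{\mathbf{r}}(h)+1}^{k-1}r_j\le h$. Put $\delta_{\mathbf{r}}(h)=h-\sum_{j=0}^{I_{\mathbf{r}}(h)-1}r_j$, $\theta_{\mathbf{r}}(h)=h-\sum_{j=M_{\mathbf{r}}(h)+1}^{k-1}r_j$, and $$L(\mathbf{r},h)=\sum_{j=M_{\mathbf{r}}(h)+1}^{k-1}j r_j-\sum_{j=0}^{I_{\mathbf{r}}(h)-1}j r_j+M_{\mathbf{r}}(h)\,\theta_{\mathbf{r}}(h)-I_{\mathbf{r}}(h)\,\delta_{\mathbf{r}}(h)+1.$$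 *)

theory Defs
  imports Main
begin

text \<open>A tuple of multiplicity bounds \<open>r\<^sub>0, \<dots>, r\<^sub>k\<^sub>-\<^sub>1\<close> is a list \<open>r\<close> with \<open>k = length r\<close>.
  A \<open>k\<close>-element set \<open>A = {a\<^sub>0 < \<dots> < a\<^sub>k\<^sub>-\<^sub>1}\<close> is indexed increasingly by
  \<open>a\<^sub>i = sorted_list_of_set A ! i\<close>, so \<open>gen_sumset\<close> is meaningful for \<open>card A = length r\<close>.\<close>

definition gen_sumset :: "int list \<Rightarrow> int \<Rightarrow> int set \<Rightarrow> int set" where
  "gen_sumset r h A =
     {(\<Sum>i<length r. s i * sorted_list_of_set A ! i) | s :: nat \<Rightarrow> int.
        (\<forall>i<length r. 0 \<le> s i \<and> s i \<le> r ! i) \<and> (\<Sum>i<length r. s i) = h}"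

text \<open>The two extremal indices exist whenever \<open>h \<ge> 0\<close>. The second one is an integer, since it may
  be \<open>-1\<close>; the index set \<open>{nat (M + 1)..<k}\<close> stands for \<open>M + 1 \<le> j \<le> k - 1\<close>.\<close>

definition I_idx :: "int list \<Rightarrow> int \<Rightarrow> nat" where
  "I_idx r h = (GREATEST i. i \<le> length r \<and> (\<Sum>j<i. r ! j) \<le> h)"

definition M_idx :: "int list \<Rightarrow> int \<Rightarrow> int" where
  "M_idx r h = (LEAST m. - 1 \<le> m \<and> m \<le> int (length r) - 1 \<and>
     (\<Sum>j\<in>{nat (m + 1)..<length r}. r ! j) \<le> h)"

definition delta :: "int list \<Rightarrow> int \<Rightarrow> int" where
  "delta r h = h - (\<Sum>j<I_idx r h. r ! j)"

definition theta :: "int list \<Rightarrow> int \<Rightarrow> int" where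
  "theta r h = h - (\<Sum>j\<in>{nat (M_idx r h + 1)..<length r}. r ! j)"

definition L :: "int list \<Rightarrow> int \<Rightarrow> int" where
  "L r h =
     (\<Sum>j\<in>{nat (M_idx r h + 1)..<length r}. int j * r ! j)
     - (\<Sum>j<I_idx r h. int j * r ! j)
     + M_idx r h * theta r h - int (I_idx r h) * delta r h + 1"

definition arith_prog :: "nat \<Rightarrow> int set \<Rightarrow> bool" where
  "arith_prog n A \<longleftrightarrow> (\<exists>a d. d > 0 \<and> A = {a + int i * d | i. i < n})"

end

theory Submission
  imports Defs
begin

text \<open>Write \<open>x = s\<^sub>0\<close> and \<open>z = s\<^sub>2\<close>, so that \<open>s\<^sub>1 = h - x - z\<close>, and put \<open>p = a\<^sub>1 - a\<^sub>0\<close>, \<open>q = a\<^sub>2 - a\<^sub>1\<close>. Up to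
  the translation by \<open>h a\<^sub>1\<close>, the sums are the values of \<open>z q - x p\<close> on the lattice points of a
  rectangle cut by the strip \<open>h - r\<^sub>1 \<le> x + z \<le> h\<close>, and \<open>L - 1\<close> is the width of the range of \<open>z - x\<close>
  there. From every point one can walk, by unit steps increasing both \<open>z q - x p\<close> and \<open>z - x\<close>, to the
  point maximising \<open>z - x\<close>, and backwards to the minimising one, so there are always at least \<open>L\<close>
  sums. If \<open>p = q\<close> the sums depend on \<open>z - x\<close> only; the same holds if \<open>r\<^sub>1 = 1\<close>, as the parity of
  \<open>z - x\<close> then determines \<open>x + z\<close>. If \<open>r\<^sub>1 \<ge> 2\<close> the region contains a unit square, and when \<open>p \<noteq> q\<close> the
  two ways of going around it give one sum more than a single walk.\<close>

text \<open>The arguments \<open>a\<close>, \<open>b\<close>, \<open>c\<close> are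
  \<open>r\<^sub>0\<close>, \<open>r\<^sub>2\<close>, \<open>r\<^sub>1\<close> in this order:
  \<open>c\<close> bounds the eliminated middle coordinate \<open>h - x - z\<close>.\<close>

definition slab :: "int \<Rightarrow> int \<Rightarrow> int \<Rightarrow> int \<Rightarrow> (int \<times> int) set" where
  "slab a b c h = {(x, z). 0 \<le> x \<and> x \<le> a \<and> 0 \<le> z \<and> z \<le> b \<and> h - c \<le> x + z \<and> x + z \<le> h}"

definition val :: "int \<Rightarrow> int \<Rightarrow> int \<times> int \<Rightarrow> int" where
  "val p q = (\<lambda>(x, z). z * q - x * p)"

text \<open>The maximum of \<open>x - z\<close> on \<open>slab a b c h\<close>; by symmetry \<open>corner b c h\<close> is that of \<open>z - x\<close>.\<close>

definition corner :: "int \<Rightarrow> int \<Rightarrow> int \<Rightarrow> int" where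
  "corner a c h = min a h - max 0 (h - c - min a h)"

lemma finite_slab: "finite (slab a b c h)"
  by (rule finite_subset[of _ "{0..a} \<times> {0..b}"]) (auto simp: slab_def)

lemma slab_swap: "(x, z) \<in> slab a b c h \<longleftrightarrow> (z, x) \<in> slab b a c h"
  by (auto simp: slab_def)

lemma slab_le_corner: "(x, z) \<in> slab a b c h \<Longrightarrow> x - z \<le> corner a c h"
  by (auto simp: slab_def corner_def min_def max_def)

text \<open>The witness takes \<open>x\<close> as large and then \<open>z\<close> as small as
  possible, so it attains \<open>x - z = corner a c h\<close>.\<close>

lemma slab_nonempty:
  assumes "0 \<le> a" "0 \<le> b" "0 \<le> c" "0 \<le> h" "h \<le> a + b + c"
  shows "(min a h, max 0 (h - c - min a h)) \<in> slab a b c h"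
  using assms by (auto simp: slab_def)

text \<open>If both steps are blocked, then \<open>x = a\<close> or \<open>x + z = h\<close>, and
  \<open>z = 0\<close> or \<open>x + z = h - c\<close>. As \<open>c > 0\<close>, the two edges of
  the strip cannot block together, and in each remaining case \<open>x - z\<close> is already
  maximal.\<close>

lemma slab_descent:
  assumes "c > 0" "(x, z) \<in> slab a b c h" "x - z < corner a c h"
  shows "(x + 1, z) \<in> slab a b c h \<or> (x, z - 1) \<in> slab a b c h"
  using assms unfolding slab_def corner_def min_def max_def mem_Collect_eq prod.case
  by (smt (verit))

section \<open>Counting values along monotone lattice walks\<close>

text \<open>Each descent step lowers \<open>val\<close> by \<open>p\<close> or \<open>q\<close>,
  hence leaves behind a new value, while \<open>z - x + corner a c h\<close> counts the steps still
  to be made.\<close>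

lemma card_below:
  assumes "p > 0" "q > 0" "c > 0" "(x, z) \<in> slab a b c h"
  shows "z - x + corner a c h + 1
    \<le> int (card {v \<in> val p q ` slab a b c h. v \<le> val p q (x, z)})"
  using assms(4)
proof (induction "nat (z - x + corner a c h)" arbitrary: x z rule: less_induct)
  case less
  let ?B = "\<lambda>w. {v \<in> val p q ` slab a b c h. v \<le> w}"
  have fin: "finite (?B w)" for w
    by (simp add: finite_slab)
  show ?case
  proof (cases "x - z < corner a c h")
    case False
    have "val p q (x, z) \<in> ?B (val p q (x, z))"
      using less.prems by blast
    then have "0 < card (?B (val p q (x, z)))"
      using fin card_gt_0_iff by blast
    with False show ?thesis by linarith
  next
    case True
    then obtain x' z' where step: "(x', z') \<in> slab a b c h" "z' - x' = z - x - 1"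
        "x' = x + 1 \<and> z' = z \<or> x' = x \<and> z' = z - 1"
      using slab_descent[OF assms(3) less.prems True] by fastforce
    have lt: "val p q (x', z') < val p q (x, z)"
      using step(3) assms(1,2) by (auto simp: val_def algebra_simps)
    have "insert (val p q (x, z)) (?B (val p q (x', z'))) \<subseteq> ?B (val p q (x, z))"
      using lt less.prems by auto
    then have "card (insert (val p q (x, z)) (?B (val p q (x', z')))) \<le> card (?B (val p q (x, z)))"
      using fin card_mono by blast
    moreover have "card (insert (val p q (x, z)) (?B (val p q (x', z'))))
        = Suc (card (?B (val p q (x', z'))))"
      using lt by (intro card_insert_disjoint fin) auto
    moreover have "z' - x' + corner a c h + 1 \<le> int (card (?B (val p q (x', z'))))"
      using less.hyps[OF _ step(1)] step(2) True by simp
    ultimately show ?thesis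
      using step(2) by linarith
  qed
qed

text \<open>Swapping the coordinates negates \<open>val\<close> and exchanges \<open>p\<close> with
  \<open>q\<close> and \<open>a\<close> with \<open>b\<close>, which turns upward walks into
  downward ones.\<close>

lemma card_above:
  assumes "p > 0" "q > 0" "c > 0" "(x, z) \<in> slab a b c h"
  shows "x - z + corner b c h + 1
    \<le> int (card {v \<in> val p q ` slab a b c h. val p q (x, z) \<le> v})"
proof -
  have neg: "val p q (x, z) = - val q p (z, x)" for x z
    by (simp add: val_def)
  have "{v \<in> val p q ` slab a b c h. val p q (x, z) \<le> v}
      = uminus ` {v \<in> val q p ` slab b a c h. v \<le> val q p (z, x)}"
  proof (rule set_eqI)
    fix v
    have "v \<in> val p q ` slab a b c h \<longleftrightarrow> - v \<in> val q p ` slab b a c h"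
      using slab_swap[of _ _ a b c h] by (force simp: image_iff neg)
    moreover have "v \<in> uminus ` S \<longleftrightarrow> - v \<in> S" for S :: "int set"
      by force
    ultimately show "v \<in> {v \<in> val p q ` slab a b c h. val p q (x, z) \<le> v} \<longleftrightarrow>
        v \<in> uminus ` {v \<in> val q p ` slab b a c h. v \<le> val q p (z, x)}"
      by (auto simp: neg)
  qed
  then have "card {v \<in> val p q ` slab a b c h. val p q (x, z) \<le> v}
      = card {v \<in> val q p ` slab b a c h. v \<le> val q p (z, x)}"
    by (simp add: card_image)
  then show ?thesis
    using card_below[OF assms(2,1,3), of z x b a h] assms(4) slab_swap[of x z] by simp
qed

text \<open>A walk upwards from the point minimising \<open>z - x\<close> traverses the whole range
  of \<open>z - x\<close>.\<close>

lemma card_val_lower: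
  assumes "p > 0" "q > 0" "0 \<le> a" "0 \<le> b" "c > 0" "0 \<le> h" "h \<le> a + b + c"
  shows "corner a c h + corner b c h + 1 \<le> int (card (val p q ` slab a b c h))"
proof -
  let ?x = "min a h" and ?z = "max 0 (h - c - min a h)"
  let ?V = "val p q ` slab a b c h"
  have "card {v \<in> ?V. val p q (?x, ?z) \<le> v} \<le> card ?V"
    by (intro card_mono) (auto simp: finite_slab)
  then show ?thesis
    using card_above[OF assms(1,2,5) slab_nonempty[of a b c h]] assms
    unfolding corner_def[of a c h] by linarith
qed

text \<open>The values factor through \<open>z - x\<close>, which lies in an integer interval; the
  bound \<open>-1\<close> ensures that the length formula for this interval is not truncated at
  0.\<close>

lemma card_val_upper:
  assumes "-1 \<le> corner a c h + corner b c h"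
    and "\<And>u. u \<in> slab a b c h \<Longrightarrow> val p q u = g (snd u - fst u)"
  shows "int (card (val p q ` slab a b c h)) \<le> corner a c h + corner b c h + 1"
proof -
  have "val p q ` slab a b c h \<subseteq> g ` {- corner a c h..corner b c h}"
  proof (rule image_subsetI)
    fix u assume u: "u \<in> slab a b c h"
    have "fst u - snd u \<le> corner a c h" "snd u - fst u \<le> corner b c h"
      using u slab_le_corner[of "fst u" "snd u" a b c h] slab_le_corner[of "snd u" "fst u" b a c h]
        slab_swap[of "fst u" "snd u"] by auto
    then show "val p q u \<in> g ` {- corner a c h..corner b c h}"
      using assms(2)[OF u] by auto
  qed
  then have "card (val p q ` slab a b c h) \<le> card {- corner a c h..corner b c h}"
    by (meson card_image_le card_mono finite_atLeastAtMost_int finite_imageI order_trans)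
  then show ?thesis
    using assms(1) by simp
qed

lemma card_val_eq:
  assumes "p > 0" "q > 0" "0 \<le> a" "0 \<le> b" "c > 0" "0 \<le> h" "h \<le> a + b + c"
    and "\<And>u. u \<in> slab a b c h \<Longrightarrow> val p q u = g (snd u - fst u)"
  shows "int (card (val p q ` slab a b c h)) = corner a c h + corner b c h + 1"
proof -
  have "(min a h, max 0 (h - c - min a h)) \<in> slab a b c h"
    using slab_nonempty[of a b c h] assms by simp
  then have "0 \<le> corner a c h + corner b c h"
    using slab_le_corner[of _ _ a b c h] slab_le_corner[of _ _ b a c h] slab_swap[of _ _ a b c h]
    by (smt (verit))
  then show ?thesis
    using card_val_upper[of a c h b p q g] card_val_lower[OF assms(1-7)] assms(8) by force
qed

text \<open>Values up to that at \<open>(x, z)\<close> and values from that at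
  \<open>(x - 1, z + 1)\<close> on number at least \<open>corner a c h + corner b c h\<close>
  together. The other two corners of the square lie strictly between and differ as
  \<open>p \<noteq> q\<close>, adding two more.\<close>

lemma card_val_strict:
  assumes "p > 0" "q > 0" "p \<noteq> q" "c > 0" "(x, z) \<in> slab a b c h" "(x - 1, z) \<in> slab a b c h"
    "(x, z + 1) \<in> slab a b c h" "(x - 1, z + 1) \<in> slab a b c h"
  shows "corner a c h + corner b c h + 1 < int (card (val p q ` slab a b c h))"
proof -
  let ?V = "val p q ` slab a b c h"
  let ?B = "{v \<in> ?V. v \<le> val p q (x, z)}"
  let ?T = "{v \<in> ?V. val p q (x - 1, z + 1) \<le> v}"
  let ?S = "{val p q (x - 1, z), val p q (x, z + 1)}"
  have vals: "val p q (x - 1, z) = val p q (x, z) + p" "val p q (x, z + 1) = val p q (x, z) + q"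
    "val p q (x - 1, z + 1) = val p q (x, z) + p + q"
    by (auto simp: val_def algebra_simps)
  have fin: "finite ?B" "finite ?T" "finite ?S" "finite ?V"
    by (auto simp: finite_slab)
  have "card ?B + card ?S + card ?T = card (?B \<union> ?S \<union> ?T)"
  proof -
    have "?B \<inter> ?S = {}" "(?B \<union> ?S) \<inter> ?T = {}"
      using assms(1,2) by (auto simp: vals)
    then show ?thesis
      using fin by (simp only: card_Un_disjoint finite_Un)
  qed
  also have "\<dots> \<le> card ?V"
    using assms by (intro card_mono fin) auto
  finally have "card ?B + card ?S + card ?T \<le> card ?V" .
  moreover have "card ?S = 2"
    using assms(3) by (auto simp: vals)
  ultimately show ?thesis
    using card_below[OF assms(1,2,4,5)] card_above[OF assms(1,2,4,8)] by linarith
qed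

lemma slab_has_square:
  assumes "a > 0" "b > 0" "c \<ge> 2" "2 \<le> h" "h \<le> a + b + c - 2"
  obtains x z where "(x, z) \<in> slab a b c h" "(x - 1, z) \<in> slab a b c h"
    "(x, z + 1) \<in> slab a b c h" "(x - 1, z + 1) \<in> slab a b c h"
proof -
  \<comment> \<open>The coordinate sums over the square run from \<open>t - 1\<close> to
    \<open>t + 1\<close>; \<open>t\<close> is the largest choice with \<open>t + 1 \<le> h\<close>
    that leaves room for \<open>x \<le> a\<close> and \<open>z + 1 \<le> b\<close>.\<close>
  define t where "t = min (h - 1) (a + b - 1)"
  define x where "x = min a t"
  show ?thesis
    by (rule that[of x "t - x"])
      (use assms in \<open>auto simp: slab_def t_def x_def min_def split: if_splits\<close>)
qed

section \<open>Translation of sumsets, extremal indices and progressions for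
  \<open>k = 3\<close>\<close>

lemma sorted_list_of_triple:
  fixes a b c :: int
  assumes "a < b" "b < c"
  shows "sorted_list_of_set {a, b, c} = [a, b, c]"
  using sorted_list_of_set.idem_if_sorted_distinct[of "[a, b, c]"] assms by simp

lemma sum_lessThan_3: "sum f {..<3::nat} = f 0 + f 1 + f 2" for f :: "nat \<Rightarrow> int"
  by (simp add: eval_nat_numeral)

lemma all_less_3: "(\<forall>i<3::nat. P i) \<longleftrightarrow> P 0 \<and> P 1 \<and> P 2"
  by (auto simp: eval_nat_numeral less_Suc_eq)

lemma gen_sumset_3:
  assumes "a0 < a1" "a1 < a2"
  shows "gen_sumset [r0, r1, r2] h {a0, a1, a2}
    = (\<lambda>v. h * a1 + v) ` val (a1 - a0) (a2 - a1) ` slab r0 r2 r1 h"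
    (is "?G = ?I")
proof (rule set_eqI)
  fix v
  have len: "length [r0, r1, r2] = 3" by simp
  have "v \<in> ?G \<longleftrightarrow> (\<exists>s :: nat \<Rightarrow> int. v = s 0 * a0 + s 1 * a1 + s 2 * a2 \<and>
      (0 \<le> s 0 \<and> s 0 \<le> r0) \<and> (0 \<le> s 1 \<and> s 1 \<le> r1) \<and> (0 \<le> s 2 \<and> s 2 \<le> r2) \<and>
      s 0 + s 1 + s 2 = h)"
    unfolding gen_sumset_def sorted_list_of_triple[OF assms] len sum_lessThan_3 all_less_3
    by (simp add: eval_nat_numeral)
  also have "\<dots> \<longleftrightarrow> v \<in> ?I"
  proof
    assume "\<exists>s :: nat \<Rightarrow> int. v = s 0 * a0 + s 1 * a1 + s 2 * a2 \<and>
      (0 \<le> s 0 \<and> s 0 \<le> r0) \<and> (0 \<le> s 1 \<and> s 1 \<le> r1) \<and> (0 \<le> s 2 \<and> s 2 \<le> r2) \<and>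
      s 0 + s 1 + s 2 = h"
    then obtain s :: "nat \<Rightarrow> int" where s: "v = s 0 * a0 + s 1 * a1 + s 2 * a2"
      "0 \<le> s 0" "s 0 \<le> r0" "0 \<le> s 1" "s 1 \<le> r1" "0 \<le> s 2" "s 2 \<le> r2" "h = s 0 + s 1 + s 2"
      by blast
    have "(s 0, s 2) \<in> slab r0 r2 r1 h"
      using s by (simp add: slab_def)
    moreover have "v = h * a1 + val (a1 - a0) (a2 - a1) (s 0, s 2)"
      using s by (simp add: val_def algebra_simps)
    ultimately show "v \<in> ?I" by blast
  next
    assume "v \<in> ?I"
    then obtain x z where xz: "(x, z) \<in> slab r0 r2 r1 h"
      "v = h * a1 + val (a1 - a0) (a2 - a1) (x, z)" by auto
    then show "\<exists>s :: nat \<Rightarrow> int. v = s 0 * a0 + s 1 * a1 + s 2 * a2 \<and>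
      (0 \<le> s 0 \<and> s 0 \<le> r0) \<and> (0 \<le> s 1 \<and> s 1 \<le> r1) \<and> (0 \<le> s 2 \<and> s 2 \<le> r2) \<and>
      s 0 + s 1 + s 2 = h"
      by (intro exI[of _ "\<lambda>i. if i = 0 then x else if i = 1 then h - x - z else z"])
        (auto simp: slab_def val_def algebra_simps)
  qed
  finally show "v \<in> ?G \<longleftrightarrow> v \<in> ?I" .
qed

lemma card_gen_sumset_3:
  assumes "a0 < a1" "a1 < a2"
  shows "card (gen_sumset [r0, r1, r2] h {a0, a1, a2})
    = card (val (a1 - a0) (a2 - a1) ` slab r0 r2 r1 h)"
  unfolding gen_sumset_3[OF assms] by (rule card_image) (auto simp: inj_on_def)

text \<open>The strict bound on \<open>h\<close> excludes the index 3, where all multiplicities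
  would be exhausted.\<close>

lemma I_idx_3:
  assumes "r0 > 0" "r1 > 0" "r2 > 0" "0 \<le> h" "h < r0 + r1 + r2"
  shows "I_idx [r0, r1, r2] h = (if h < r0 then 0 else if h < r0 + r1 then 1 else 2)"
  unfolding I_idx_def
proof (rule Greatest_equality, goal_cases)
  case 1
  show ?case using assms by (auto simp: eval_nat_numeral)
next
  case (2 y)
  then have "y = 0 \<or> y = 1 \<or> y = 2 \<or> y = 3" by auto
  with 2 show ?case using assms by (auto simp: eval_nat_numeral)
qed

lemma M_idx_3:
  assumes "r0 > 0" "r1 > 0" "r2 > 0" "0 \<le> h" "h < r0 + r1 + r2"
  shows "M_idx [r0, r1, r2] h = (if h < r2 then 2 else if h < r1 + r2 then 1 else 0)"
  unfolding M_idx_def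
proof (rule Least_equality, goal_cases)
  case 1
  show ?case using assms by (auto simp: eval_nat_numeral)
next
  case (2 y)
  then have "y = -1 \<or> y = 0 \<or> y = 1 \<or> y = 2" by auto
  with 2 show ?case using assms by (auto simp: eval_nat_numeral)
qed

text \<open>The two halves of \<open>L\<close> are the greedy maximum and minimum of
  \<open>s\<^sub>1 + 2 * s\<^sub>2 = h + (z - x)\<close>, namely \<open>h + corner r2 r1 h\<close>
  and \<open>h - corner r0 r1 h\<close>.\<close>

lemma L_3:
  assumes "r0 > 0" "r1 > 0" "r2 > 0" "0 \<le> h" "h < r0 + r1 + r2"
  shows "L [r0, r1, r2] h = corner r0 r1 h + corner r2 r1 h + 1"
  unfolding L_def delta_def theta_def I_idx_3[OF assms] M_idx_3[OF assms] corner_def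
  using assms by (auto simp: eval_nat_numeral min_def max_def)

lemma arith_prog_3:
  assumes "a0 < a1" "a1 < a2"
  shows "arith_prog 3 {a0, a1, a2} \<longleftrightarrow> a1 - a0 = a2 - a1"
proof -
  have eq: "{a + int i * d | i. i < 3} = {a, a + d, a + 2 * d}" for a d :: int
    by (auto simp: eval_nat_numeral less_Suc_eq)
  show ?thesis
  proof
    assume "arith_prog 3 {a0, a1, a2}"
    then obtain a d where ad: "d > 0" "{a0, a1, a2} = {a, a + d, a + 2 * d}"
      unfolding arith_prog_def eq by blast
    \<comment> \<open>Equal sets have the same increasing enumeration, so the terms match in
      order.\<close>
    have "[a0, a1, a2] = [a, a + d, a + 2 * d]"
      using sorted_list_of_triple[OF assms] sorted_list_of_triple[of a "a + d" "a + 2 * d"] ad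
      by simp
    then show "a1 - a0 = a2 - a1" by simp
  next
    assume "a1 - a0 = a2 - a1"
    then have "a1 = a0 + (a1 - a0)" "a2 = a0 + 2 * (a1 - a0)" by auto
    then show "arith_prog 3 {a0, a1, a2}"
      unfolding arith_prog_def eq using assms
      by (intro exI[of _ a0] exI[of _ "a1 - a0"]) auto
  qed
qed

theorem theorem3:
  fixes A :: "int set" and a0 a1 a2 r0 r1 r2 h :: int
  assumes "A = {a0, a1, a2}" and "a0 < a1" and "a1 < a2"
    and "r0 > 0" and "r1 > 0" and "r2 > 0"
    and "2 \<le> h" and "h \<le> r0 + r1 + r2 - 2"
  shows "(r1 = 1 \<longrightarrow> int (card (gen_sumset [r0, r1, r2] h A)) = L [r0, r1, r2] h) \<and>
    (r1 \<ge> 2 \<longrightarrow>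
      (int (card (gen_sumset [r0, r1, r2] h A)) = L [r0, r1, r2] h \<longleftrightarrow> arith_prog 3 A))"
proof -
  define p q where "p = a1 - a0" and "q = a2 - a1"
  have pq: "p > 0" "q > 0"
    using assms by (auto simp: p_def q_def)
  let ?V = "val p q ` slab r0 r2 r1 h"
  let ?N = "corner r0 r1 h + corner r2 r1 h + 1"
  have card: "card (gen_sumset [r0, r1, r2] h A) = card ?V"
    unfolding p_def q_def using card_gen_sumset_3 assms by blast
  have L: "L [r0, r1, r2] h = ?N"
    using assms by (intro L_3) auto
  have ap: "arith_prog 3 A \<longleftrightarrow> p = q"
    unfolding p_def q_def using arith_prog_3 assms by blast
  have eqI: "int (card ?V) = ?N"
    if "\<And>u. u \<in> slab r0 r2 r1 h \<Longrightarrow> val p q u = g (snd u - fst u)" for g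
    by (rule card_val_eq[OF pq _ _ _ _ _ that]) (use assms in auto)
  have "int (card ?V) = ?N" if "r1 = 1"
  proof -
    \<comment> \<open>On the slab \<open>x + z\<close> is the one of \<open>h\<close>, \<open>h - 1\<close> congruent to \<open>w = z - x\<close> modulo 2.\<close>
    define t where "t w = (if even (h - w) then h else h - 1)" for w
    \<comment> \<open>Solving \<open>z - x = w\<close> and \<open>x + z = t w\<close> recovers the
      point from \<open>w\<close>.\<close>
    define g where "g w = val p q ((t w - w) div 2, (t w + w) div 2)" for w
    show ?thesis
    proof (rule eqI[of g])
      fix u assume u: "u \<in> slab r0 r2 r1 h"
      obtain x z where xz: "u = (x, z)" by fastforce
      then consider "h = x + z" | "h = x + z + 1"
        using u \<open>r1 = 1\<close> unfolding slab_def by simp linarith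
      then have "t (z - x) = x + z"
        by cases (auto simp: t_def)
      then show "val p q u = g (snd u - fst u)"
        by (simp add: xz g_def)
    qed
  qed
  moreover have "int (card ?V) = ?N" if "p = q"
    by (rule eqI[of "\<lambda>w. w * q"]) (auto simp: that val_def algebra_simps)
  moreover have "int (card ?V) \<noteq> ?N" if "r1 \<ge> 2" "p \<noteq> q"
  proof -
    obtain x z where "(x, z) \<in> slab r0 r2 r1 h" "(x - 1, z) \<in> slab r0 r2 r1 h"
        "(x, z + 1) \<in> slab r0 r2 r1 h" "(x - 1, z + 1) \<in> slab r0 r2 r1 h"
      by (rule slab_has_square[of r0 r2 r1 h]) (use assms \<open>r1 \<ge> 2\<close> in auto)
    then show ?thesis
      using card_val_strict[OF pq \<open>p \<noteq> q\<close> \<open>r1 > 0\<close>] by fastforce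
  qed
  ultimately show ?thesis
    unfolding card L ap by blast
qed

end
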